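(* Let $A$ be a finite alphabet. For all non-empty sentences $I,J$ over $A$, the coloured ribbon non-commutative Schur functions in $\mathrm{NSym}_A$ satisfy $$R_IR_J=R_{I\cdot J}+R_{I\odot J}.$$
   Context: $\Bbbk$ is a field of characteristic zero. A sentence $I=(w_1,\dots,w_m)$ over $A$ is a finite sequence of non-empty words in letters of $A$; $1$ is the empty sentence. The concatenation of $I=(w_1,\dots,w_m)$ and $J=(v_1,\dots,v_n)$ is $I\cdot J=(w_1,\dots,w_m,v_1,\dots,v_n)$, and the near-concatenation of non-empty sentences is $I\odot J=(w_1,\dots,w_{m-1},w_mv_1,v_2,\dots,v_n)$. Write $J\preccurlyeq I$ ($J$ refines $I$) if the words of $I$ can be obtained by concatenating adjacent words of $J$. $\mathrm{NSym}_A$ is the $\Bbbk$-algebra with linear basis $(H_I)$ indexed by sentences over $A$ and product $H_IH_J=H_{I\cdot J}$. It carries a Hopf algebra structure graded by the total number of letters; $\mathrm{QSym}_A$ is its graded dual, with basis $(M_I)$ dual to $(H_I)$: $\langle M_I,H_J\rangle=\delta_{I,J}$. The fundamental functions $F_I=\sum_{J\preccurlyeq I}M_J$ form a basis of $\mathrm{QSym}_A$, and $(R_I)$ is the basis of $\mathrm{NSym}_A$ dual to it: $\langle F_I,R_J\rangle=\delta_{I,J}$. *)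

theory Defs
  imports Complex_Main "HOL-Library.Poly_Mapping"
begin

section \<open>Sentences\<close>

typedef 'a sentence = "{I :: 'a list list. [] \<notin> set I}"
  morphisms words Abs_sentence
  by (rule exI[of _ "[]"]) simp

setup_lifting type_definition_sentence

text \<open>The monoid structure is written additively because this is what the library's monoid
  algebra \<^typ>\<open>'b \<Rightarrow>\<^sub>0 'k\<close> expects of its exponents \<^typ>\<open>'b\<close>: \<open>0\<close> is the empty sentence
  and \<open>+\<close> is concatenation.\<close>

instantiation sentence :: (type) monoid_add
begin

lift_definition zero_sentence :: "'a sentence" is "[]" by simp

lift_definition plus_sentence :: "'a sentence \<Rightarrow> 'a sentence \<Rightarrow> 'a sentence" is "(@)" by simp

instance by standard (transfer; simp)+

end

abbreviation sconcat :: "'a sentence \<Rightarrow> 'a sentence \<Rightarrow> 'a sentence"  (infixl "\<cdot>" 68) where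
  "I \<cdot> J \<equiv> I + J"

text \<open>Only meaningful for two non-empty sentences; otherwise it returns the plain concatenation.\<close>

lift_definition near_concat :: "'a sentence \<Rightarrow> 'a sentence \<Rightarrow> 'a sentence"  (infixl "\<odot>" 68) is
  "\<lambda>I J. if I = [] \<or> J = [] then I @ J else butlast I @ [last I @ hd J] @ tl J"
  by (auto dest: in_set_butlastD list.set_sel(2) hd_in_set split: if_splits)

definition letters :: "'a sentence \<Rightarrow> nat" where
  "letters I = length (concat (words I))"

text \<open>\<open>J\<close> is cut into consecutive blocks, and the words of \<open>I\<close> are the concatenated blocks.
  Blocks are automatically non-empty since the words of \<open>I\<close> are.\<close>

definition refines :: "'a sentence \<Rightarrow> 'a sentence \<Rightarrow> bool"  (infix "\<preceq>" 50) where
  "J \<preceq> I \<longleftrightarrow> (\<exists>blocks. words J = concat blocks \<and> words I = map concat blocks)"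


section \<open>The algebra of coloured non-commutative symmetric functions\<close>

text \<open>The algebra with basis indexed by sentences and multiplied by concatenation is the monoid
  algebra of the monoid of sentences, with the library's convolution product.\<close>

type_synonym ('a, 'k) nsym = "'a sentence \<Rightarrow>\<^sub>0 'k"

definition nsym_H :: "'a sentence \<Rightarrow> ('a, 'k::field_char_0) nsym" where
  "nsym_H I = Poly_Mapping.single I 1"

lemma nsym_H_mult: "nsym_H I * nsym_H J = nsym_H (I \<cdot> J)"
  by (simp add: nsym_H_def mult_single)

definition nsym_scale :: "'k \<Rightarrow> ('a, 'k) nsym \<Rightarrow> ('a, 'k::field_char_0) nsym" where
  "nsym_scale c = Poly_Mapping.map ((*) c)"

lemma nsym_scale_conv_mult: "nsym_scale c x = Poly_Mapping.single 0 c * x"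
  by (simp add: nsym_scale_def mult_map_scale_conv_mult)

lemma lookup_nsym_scale: "Poly_Mapping.lookup (nsym_scale c x) I = c * Poly_Mapping.lookup x I"
  by (simp add: nsym_scale_def Poly_Mapping.map.rep_eq when_def)

interpretation nsym: vector_space nsym_scale
  by standard (auto simp: poly_mapping_eq_iff fun_eq_iff lookup_nsym_scale lookup_add algebra_simps)

lemma vector_space_mult: "vector_space ((*) :: 'k::field \<Rightarrow> 'k \<Rightarrow> 'k)"
  by standard (simp_all add: algebra_simps)

definition nsym_homogeneous :: "nat \<Rightarrow> ('a, 'k::field_char_0) nsym set" where
  "nsym_homogeneous n = nsym.span (nsym_H ` {I. letters I = n})"


section \<open>Its graded dual\<close>

text \<open>Elements of the graded dual are the linear functionals that vanish on all but finitely many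
  homogeneous components; \<open>pairing\<close> evaluates a functional.\<close>

typedef (overloaded) ('a, 'k::field_char_0) qsym =
  "{\<phi> :: ('a, 'k) nsym \<Rightarrow> 'k. Vector_Spaces.linear nsym_scale (*) \<phi> \<and>
     finite {n. \<exists>x \<in> nsym_homogeneous n. \<phi> x \<noteq> 0}}"
  morphisms pairing Abs_qsym
  by (rule exI[of _ "\<lambda>_. 0"])
    (simp add: Vector_Spaces.linear_iff vector_space_mult nsym.vector_space_axioms)

lifting_forget sentence.lifting
setup_lifting type_definition_qsym

notation pairing ("\<langle>_, _\<rangle>")

instantiation qsym :: (type, field_char_0) comm_monoid_add
begin

lift_definition zero_qsym :: "('a, 'b) qsym" is "\<lambda>_. 0"
  by (auto simp: Vector_Spaces.linear_iff vector_space_mult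
      nsym.vector_space_axioms)

lift_definition plus_qsym :: "('a, 'b) qsym \<Rightarrow> ('a, 'b) qsym \<Rightarrow> ('a, 'b) qsym" is
  "\<lambda>\<phi> \<psi> x. \<phi> x + \<psi> x"
proof (intro CollectI conjI; elim CollectE conjE)
  fix \<phi> \<psi> :: "('a, 'b) nsym \<Rightarrow> 'b"
  assume "Vector_Spaces.linear nsym_scale (*) \<phi>" "Vector_Spaces.linear nsym_scale (*) \<psi>"
  then show "Vector_Spaces.linear nsym_scale (*) (\<lambda>x. \<phi> x + \<psi> x)"
    by (simp add: Vector_Spaces.linear_iff algebra_simps)
next
  fix \<phi> \<psi> :: "('a, 'b) nsym \<Rightarrow> 'b"
  assume "finite {n. \<exists>x \<in> nsym_homogeneous n. \<phi> x \<noteq> 0}"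
    and "finite {n. \<exists>x \<in> nsym_homogeneous n. \<psi> x \<noteq> 0}"
  then have "finite ({n. \<exists>x \<in> nsym_homogeneous n. \<phi> x \<noteq> 0} \<union>
      {n. \<exists>x \<in> nsym_homogeneous n. \<psi> x \<noteq> 0})" by simp
  then show "finite {n. \<exists>x \<in> nsym_homogeneous n. \<phi> x + \<psi> x \<noteq> 0}"
    by (rule rev_finite_subset) fastforce
qed

instance by standard (transfer; simp add: fun_eq_iff ac_simps)+

end

lift_definition qsym_M :: "'a sentence \<Rightarrow> ('a, 'k::field_char_0) qsym" is "\<lambda>I x. Poly_Mapping.lookup x I"
proof (intro CollectI conjI)
  fix I :: "'a sentence"
  show lin: "Vector_Spaces.linear nsym_scale (*) (\<lambda>x :: ('a, 'k) nsym. Poly_Mapping.lookup x I)"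
    by (simp add: Vector_Spaces.linear_iff vector_space_mult
        nsym.vector_space_axioms lookup_add lookup_nsym_scale)
  have "Poly_Mapping.lookup x I = 0" if "x \<in> nsym_homogeneous n" "letters I \<noteq> n"
    for n and x :: "('a, 'k) nsym"
    using that unfolding nsym_homogeneous_def
    by (induction rule: nsym.span_induct_alt)
      (auto simp: nsym_H_def lookup_add lookup_nsym_scale lookup_single when_def split: if_splits)
  then have "{n. \<exists>x \<in> (nsym_homogeneous n :: ('a, 'k) nsym set). Poly_Mapping.lookup x I \<noteq> 0} \<subseteq> {letters I}"
    by blast
  then show "finite {n. \<exists>x \<in> (nsym_homogeneous n :: ('a, 'k) nsym set). Poly_Mapping.lookup x I \<noteq> 0}"
    by (rule finite_subset) simp
qed

lemma pairing_qsym_M_nsym_H: "\<langle>qsym_M I, nsym_H J\<rangle> = of_bool (I = J)"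
  by (simp add: qsym_M.rep_eq nsym_H_def lookup_single when_def)

lemma finite_refinements: "finite {J. J \<preceq> I}"
proof -
  let ?w = "concat (words I)"
  let ?W = "{w. set w \<subseteq> set ?w \<and> length w \<le> length ?w}"
  let ?S = "{ws. set ws \<subseteq> ?W \<and> length ws \<le> length ?w}"
  have "words J \<in> ?S" if "J \<preceq> I" for J
  proof -
    have cc: "concat (map concat b) = concat (concat b)" for b :: "'a list list list"
      by (induction b) simp_all
    have c: "?w = concat (words J)"
      using that by (auto simp: refines_def cc)
    have "[] \<notin> set (words J)" using words[of J] by simp
    moreover have "[] \<notin> set vs \<Longrightarrow> length vs \<le> length (concat vs)" for vs :: "'a list list"
    proof (induction vs)
      case (Cons v vs) then show ?case by (cases v) auto
    qed simp
    ultimately have "length (words J) \<le> length (concat (words J))" by blast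
    moreover have "length w \<le> length (concat (words J))" if "w \<in> set (words J)" for w
      using that by (auto simp: length_concat intro!: member_le_sum_list)
    ultimately show ?thesis by (auto simp: c)
  qed
  then have "words ` {J. J \<preceq> I} \<subseteq> ?S" by blast
  moreover have "finite ?S"
    by (rule finite_lists_length_le, rule finite_lists_length_le, rule finite_set)
  ultimately have "finite (words ` {J. J \<preceq> I})" by (rule finite_subset)
  then show ?thesis by (rule finite_imageD) (simp add: inj_on_def words_inject)
qed

definition qsym_F :: "'a sentence \<Rightarrow> ('a, 'k::field_char_0) qsym" where
  "qsym_F I = (\<Sum>J | J \<preceq> I. qsym_M J)"


section \<open>Coloured ribbon functions\<close>

text \<open>The functionals \<^term>\<open>qsym_M I\<close>, hence all coefficients of an element of the algebra, are recovered
  from the \<^term>\<open>qsym_F I\<close> by triangularity, so duality alone determines the family.\<close>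

definition ribbon :: "'a sentence \<Rightarrow> ('a, 'k::field_char_0) nsym" where
  "ribbon = (THE R. \<forall>I J. \<langle>qsym_F I, R J\<rangle> = of_bool (I = J))"

end

(* The product rule with a one-word left factor, H_(w) R_(v I) = R_(w v I) + R_((wv) I), can be
   read as a recursion for R_(w v I). The family it defines is dual to (F_K), by induction on the
   length: the pairing of F_K with H_(w) x is the pairing with x of the F of K with the prefix w
   removed from its first word, and 0 if there is no such prefix. The general product rule follows
   by the same induction, with no alternating sum over coarsenings. *)

theory Submission
  imports Defs
begin

section \<open>Sentences and the refinement order\<close>

lemma Nil_notin_words [simp]: "[] \<notin> set (words I)"
  using words[of I] by simp

lemma words_Abs_sentence [simp]: "[] \<notin> set ws \<Longrightarrow> words (Abs_sentence ws) = ws"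
  by (simp add: Abs_sentence_inverse)

lemma Abs_sentence_eq_iff:
  "[] \<notin> set ws \<Longrightarrow> Abs_sentence ws = I \<longleftrightarrow> ws = words I"
  by (metis words_Abs_sentence words_inverse)

lemma refines_refl: "I \<preceq> I"
  unfolding refines_def by (rule exI[of _ "map (\<lambda>w. [w]) (words I)"]) (simp add: comp_def)

lemma length_le_length_concat:
  "[] \<notin> set (map concat bs) \<Longrightarrow> length bs \<le> length (concat bs)"
proof (induction bs)
  case (Cons b bs)
  then show ?case by (cases b) auto
qed simp

text \<open>No block is empty, so together the blocks hold at least as many words as there are
  blocks; the bound then leaves exactly one word per block.\<close>

lemma concat_eq_map_concat:
  "[] \<notin> set (map concat bs) \<Longrightarrow> length (concat bs) \<le> length bs \<Longrightarrow> concat bs = map concat bs"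
proof (induction bs)
  case (Cons b bs)
  then have "length bs \<le> length (concat bs)" "b \<noteq> []"
    using length_le_length_concat[of bs] by auto
  moreover from this have "length b \<le> 1"
    using Cons.prems(2) by simp
  ultimately obtain w where "b = [w]"
    by (cases b) auto
  with Cons show ?case by simp
qed simp

text \<open>This is the triangularity of refinement with respect to the number of words: a proper
  refinement has strictly more words.\<close>

lemma refines_length_le_imp_eq:
  assumes "J \<preceq> I" "length (words J) \<le> length (words I)"
  shows "J = I"
proof -
  obtain bs where bs: "words J = concat bs" "words I = map concat bs"
    using assms(1) unfolding refines_def by blast
  have "concat bs = map concat bs"
    using bs assms(2) Nil_notin_words[of I] by (intro concat_eq_map_concat) auto
  then show ?thesis using bs by (metis words_inject)
qed

lemma refines_0_iff: "J \<preceq> 0 \<longleftrightarrow> J = 0"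
  by (auto simp: refines_def zero_sentence.rep_eq simp flip: words_inject)

text \<open>Any block cut out of the empty sentence would be empty and yield an empty word of
  \<open>K\<close>, so there are no blocks.\<close>

lemma zero_refines_iff: "0 \<preceq> K \<longleftrightarrow> K = 0"
proof
  assume "0 \<preceq> K"
  then obtain bs where bs: "concat bs = []" "words K = map concat bs"
    by (auto simp: refines_def zero_sentence.rep_eq)
  have "concat b = []" if "b \<in> set bs" for b
    using bs(1) that by auto
  moreover have "concat b \<noteq> []" if "b \<in> set bs" for b
    using bs(2) that Nil_notin_words[of K] by (metis image_eqI list.set_map)
  ultimately have "bs = []" by (metis list.set_intros(1) neq_Nil_conv)
  with bs show "K = 0" by (simp add: zero_sentence.rep_eq flip: words_inject)
qed (simp add: refines_refl)

text \<open>The alternatives distinguish whether the first block is \<open>w\<close> alone or goes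
  on after \<open>w\<close>; in the second case its remaining words concatenate to \<open>u\<close>.
  This is the prefix removal dual to left multiplication by a one-word
  \<open>nsym_H\<close>.\<close>

lemma refines_Cons_iff:
  assumes "words J = w # ws" "words K = k # ks"
  shows "J \<preceq> K \<longleftrightarrow> k = w \<and> Abs_sentence ws \<preceq> Abs_sentence ks \<or>
    (\<exists>u. u \<noteq> [] \<and> k = w @ u \<and> Abs_sentence ws \<preceq> Abs_sentence (u # ks))"
proof -
  have ne: "w \<noteq> []" "k \<noteq> []" "[] \<notin> set ws" "[] \<notin> set ks"
    using assms Nil_notin_words[of J] Nil_notin_words[of K] by auto
  show ?thesis (is "_ \<longleftrightarrow> ?A \<or> ?B")
  proof
    assume "J \<preceq> K"
    then obtain bs where bs: "w # ws = concat bs" "k # ks = map concat bs"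
      unfolding refines_def assms by (elim exE conjE)
    then obtain b bs' where b: "bs = b # bs'" by (cases bs) auto
    then obtain b' where b': "b = w # b'" using bs ne by (cases b) auto
    show "?A \<or> ?B"
    \<comment> \<open>\<open>b'\<close> is the first block without \<open>w\<close>, so
      \<open>concat b'\<close> is the candidate for \<open>u\<close>. It is empty only if
      \<open>b'\<close> is, since the words of \<open>ws\<close> are non-empty.\<close>
    proof (cases "concat b' = []")
      case True
      moreover have "b' = []"
      proof (rule ccontr)
        assume "b' \<noteq> []"
        then have "hd b' \<in> set ws" using bs b b' by simp
        then show False using ne True \<open>b' \<noteq> []\<close> by (metis concat_eq_Nil_conv hd_in_set)
      qed
      ultimately show ?thesis using bs b b' ne by (auto simp: refines_def)
    next
      case False
      then have ?B using bs b b' ne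
        by (auto simp: refines_def intro!: exI[of _ "b' # bs'"])
      then show ?thesis ..
    qed
  next
    assume "?A \<or> ?B"
    then show "J \<preceq> K"
    proof
      assume ?A
      then obtain bs where "ws = concat bs" "ks = map concat bs" "k = w"
        using ne by (auto simp: refines_def)
      then show ?thesis unfolding refines_def assms
        by (intro exI[of _ "[w] # bs"]) simp
    next
      assume ?B
      then obtain u where u: "u \<noteq> []" "k = w @ u" "Abs_sentence ws \<preceq> Abs_sentence (u # ks)"
        by blast
      then obtain bs where "ws = concat bs" "u # ks = map concat bs"
        using ne unfolding refines_def by (metis set_ConsD words_Abs_sentence)
      note this \<open>k = w @ u\<close>
      then show ?thesis unfolding refines_def assms
        \<comment> \<open>\<open>hd bs\<close> is the block of \<open>u\<close>; putting
          \<open>w\<close> back in front makes it the block of \<open>k\<close>.\<close>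
        by (intro exI[of _ "(w # hd bs) # tl bs"]) (cases bs; auto)
    qed
  qed
qed

section \<open>Pairing with the fundamental functions\<close>

lemma pairing_sum: "finite S \<Longrightarrow> \<langle>sum f S, x\<rangle> = (\<Sum>s\<in>S. \<langle>f s, x\<rangle>)"
  by (induction S rule: finite_induct) (simp_all add: zero_qsym.rep_eq plus_qsym.rep_eq)

lemma pairing_qsym_F: "\<langle>qsym_F I, x\<rangle> = (\<Sum>J | J \<preceq> I. Poly_Mapping.lookup x J)"
  by (simp add: qsym_F_def pairing_sum finite_refinements qsym_M.rep_eq)

lemma pairing_qsym_F_add: "\<langle>qsym_F I, x + y\<rangle> = \<langle>qsym_F I, x\<rangle> + \<langle>qsym_F I, y\<rangle>"
  by (simp add: pairing_qsym_F lookup_add sum.distrib)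

lemma pairing_qsym_F_diff: "\<langle>qsym_F I, x - y\<rangle> = \<langle>qsym_F I, x\<rangle> - \<langle>qsym_F I, y\<rangle>"
  by (simp add: pairing_qsym_F lookup_minus sum_subtractf)

lemma pairing_qsym_F_single: "\<langle>qsym_F I, Poly_Mapping.single J c\<rangle> = c * of_bool (J \<preceq> I)"
  by (simp add: pairing_qsym_F lookup_single when_def finite_refinements sum.delta')

lemma poly_mapping_single_add_induct [case_names single add]:
  assumes "\<And>k c. P (Poly_Mapping.single k c)" "\<And>x y. P x \<Longrightarrow> P y \<Longrightarrow> P (x + y)"
  shows "P (x :: 'b \<Rightarrow>\<^sub>0 'c::comm_monoid_add)"
proof (induction x rule: update_induct)
  case const
  \<comment> \<open>The zero element is the monomial with coefficient 0 at an arbitrary key.\<close>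
  show ?case using assms(1)[of undefined 0] by simp
next
  case (update f k c)
  then have "Poly_Mapping.update k c f = f + Poly_Mapping.single k c"
    by (intro poly_mapping_eqI)
      (auto simp: lookup_update lookup_add lookup_single when_def in_keys_iff)
  then show ?case
    using assms(2)[OF update(3) assms(1)[of k c]] by simp
qed

text \<open>Both sides are additive in \<open>x\<close>, so monomials suffice, and there the claim
  is the assumption. In the application \<open>L\<close> is \<open>K\<close> with the prefix
  \<open>S\<close> removed.\<close>

lemma pairing_qsym_F_mult_cong:
  assumes "\<And>J. S \<cdot> J \<preceq> K \<longleftrightarrow> J \<preceq> L"
  shows "\<langle>qsym_F K, nsym_H S * x\<rangle> = \<langle>qsym_F L, x\<rangle>"
proof (induction x rule: poly_mapping_single_add_induct)
  case (single J c)
  then show ?case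
    by (simp add: nsym_H_def mult_single pairing_qsym_F_single assms)
next
  case (add x y)
  then show ?case by (simp add: distrib_left pairing_qsym_F_add)
qed

lemma pairing_qsym_F_mult_eq_0:
  assumes "\<And>J. \<not> S \<cdot> J \<preceq> K"
  shows "\<langle>qsym_F K, nsym_H S * x\<rangle> = 0"
proof (induction x rule: poly_mapping_single_add_induct)
  case (single J c)
  then show ?case
    by (simp add: nsym_H_def mult_single pairing_qsym_F_single assms)
next
  case (add x y)
  then show ?case by (simp add: distrib_left pairing_qsym_F_add)
qed

text \<open>This gives uniqueness of the dual family. Among the keys of the difference, one with the
  most words has no other key refining it, so its fundamental function reads off its non-zero
  coefficient.\<close>

lemma qsym_F_separates:
  assumes "\<And>I. \<langle>qsym_F I, x\<rangle> = \<langle>qsym_F I, y\<rangle>"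
  shows "x = y"
proof (rule ccontr)
  define z where "z = x - y"
  have z: "\<langle>qsym_F I, z\<rangle> = 0" for I
    by (simp add: z_def pairing_qsym_F_diff assms)
  assume "x \<noteq> y"
  then have "Poly_Mapping.keys z \<noteq> {}" by (simp add: z_def)
  define n where "n = Max ((\<lambda>I. length (words I)) ` Poly_Mapping.keys z)"
  have "n \<in> (\<lambda>I. length (words I)) ` Poly_Mapping.keys z"
    unfolding n_def using \<open>Poly_Mapping.keys z \<noteq> {}\<close> by (intro Max_in) auto
  then obtain I where I: "I \<in> Poly_Mapping.keys z" "length (words I) = n" by auto
  have max: "length (words J) \<le> length (words I)" if "J \<in> Poly_Mapping.keys z" for J
    unfolding I n_def using that by (intro Max_ge) auto
  have "\<langle>qsym_F I, z\<rangle> = (\<Sum>J\<in>{I}. Poly_Mapping.lookup z J)"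
    unfolding pairing_qsym_F
  proof (rule sum.mono_neutral_right)
    show "\<forall>J\<in>{J. J \<preceq> I} - {I}. Poly_Mapping.lookup z J = 0"
      using refines_length_le_imp_eq max by (metis DiffE in_keys_iff mem_Collect_eq singletonI)
  qed (auto simp: finite_refinements refines_refl)
  with z I show False by (simp add: in_keys_iff)
qed

section \<open>Ribbons by recursion\<close>

text \<open>Plain lists allow pattern matching. Both recursive calls, also the one on the merged
  word, have one word fewer, so the induction rule covers both. The values are meaningful for lists
  of non-empty words.\<close>

fun ribbon_list :: "'a list list \<Rightarrow> ('a, 'k::field_char_0) nsym" where
  "ribbon_list [] = 1"
| "ribbon_list [w] = nsym_H (Abs_sentence [w])"
| "ribbon_list (w # v # ws) =
    nsym_H (Abs_sentence [w]) * ribbon_list (v # ws) - ribbon_list ((w @ v) # ws)"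

lemma pairing_qsym_F_ribbon_list:
  "[] \<notin> set ws \<Longrightarrow>
    \<langle>qsym_F K, ribbon_list ws :: ('a, 'k::field_char_0) nsym\<rangle> = of_bool (words K = ws)"
proof (induction ws arbitrary: K rule: ribbon_list.induct)
  case 1
  \<comment> \<open>The unit of the algebra is the monomial at the empty sentence.\<close>
  have "\<langle>qsym_F K, Poly_Mapping.single 0 1 :: ('a, 'k) nsym\<rangle> = of_bool (0 \<preceq> K)"
    by (simp only: pairing_qsym_F_single mult_1)
  then show ?case
    by (auto simp: zero_refines_iff zero_sentence.rep_eq simp flip: words_inject)
next
  case (2 w)
  have "Abs_sentence [w] \<preceq> K \<longleftrightarrow> words K = [w]"
  proof (cases "words K")
    case Nil
    then have "K = 0" by (simp add: zero_sentence.rep_eq flip: words_inject)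
    with 2 Nil show ?thesis
      by (auto simp: refines_0_iff Abs_sentence_eq_iff)
  next
    case (Cons k ks)
    have [simp]: "[] \<notin> set ks" using Cons Nil_notin_words[of K] by simp
    have *: "Abs_sentence [] = (0 :: 'a sentence)"
      by (simp add: zero_sentence.rep_eq flip: words_inject)
    show ?thesis using 2
      by (subst refines_Cons_iff[OF _ Cons, of _ w "[]"])
        (auto simp: Cons * zero_refines_iff zero_sentence.rep_eq simp flip: words_inject)
  qed
  then show ?case by (simp add: nsym_H_def pairing_qsym_F_single)
next
  case (3 w v ws)
  let ?w = "Abs_sentence [w]" and ?x = "ribbon_list (v # ws) :: ('a, 'k) nsym"
  have IH: "\<langle>qsym_F L, ribbon_list (v # ws) :: ('a, 'k) nsym\<rangle> = of_bool (words L = v # ws)"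
    "\<langle>qsym_F L, ribbon_list ((w @ v) # ws) :: ('a, 'k) nsym\<rangle> = of_bool (words L = (w @ v) # ws)" for L
    using 3 by auto
  have w: "w \<noteq> []" "words (?w \<cdot> J) = w # words J" for J
    using 3 by (auto simp: plus_sentence.rep_eq)
  show ?case
  proof (cases "words K")
    case Nil
    then have "K = 0" by (simp add: zero_sentence.rep_eq flip: words_inject)
    then have "\<not> ?w \<cdot> J \<preceq> K" for J
      using w(2)[of J] by (auto simp: refines_0_iff zero_sentence.rep_eq)
    then show ?thesis
      by (simp add: pairing_qsym_F_diff IH Nil pairing_qsym_F_mult_eq_0)
  next
    case (Cons k ks)
    have ks: "[] \<notin> set ks" "k \<noteq> []" using Cons Nil_notin_words[of K] by auto
    note iff = refines_Cons_iff[OF w(2) Cons, unfolded words_inverse]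
    consider "k = w" | u where "k = w @ u" "u \<noteq> []" | "\<nexists>u. k = w @ u"
      by (metis append_Nil2)
    then show ?thesis
    proof cases
      case 1
      \<comment> \<open>The product term tests \<open>ks = v # ws\<close>; the merged term vanishes
        because \<open>v\<close> is non-empty.\<close>
      then have "?w \<cdot> J \<preceq> K \<longleftrightarrow> J \<preceq> Abs_sentence ks" for J
        by (simp add: iff)
      from pairing_qsym_F_mult_cong[OF this, of ?x] show ?thesis
        using 1 ks 3 by (auto simp: pairing_qsym_F_diff IH Cons)
    next
      case 2
      \<comment> \<open>Both terms now test \<open>u = v\<close> and \<open>ks = ws\<close>, so they
        cancel.\<close>
      then have "?w \<cdot> J \<preceq> K \<longleftrightarrow> J \<preceq> Abs_sentence (u # ks)" for J
        by (simp add: iff)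
      from pairing_qsym_F_mult_cong[OF this, of ?x] show ?thesis
        using 2 ks by (simp add: pairing_qsym_F_diff IH Cons)
    next
      case 3
      \<comment> \<open>Without the prefix \<open>w\<close> both terms vanish.\<close>
      then have "\<not> ?w \<cdot> J \<preceq> K" for J
        by (auto simp: iff)
      from pairing_qsym_F_mult_eq_0[OF this, of ?x] show ?thesis
        using 3 by (auto simp: pairing_qsym_F_diff IH Cons)
    qed
  qed
qed

text \<open>The description by \<open>THE\<close> needs existence, supplied by the recursion, and
  uniqueness, supplied by \<open>qsym_F_separates\<close>.\<close>

lemma ribbon_eq_ribbon_list: "ribbon I = (ribbon_list (words I) :: ('a, 'k::field_char_0) nsym)"
proof -
  have dual: "\<langle>qsym_F I, ribbon_list (words J) :: ('a, 'k) nsym\<rangle> = of_bool (I = J)" for I J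
    by (simp add: pairing_qsym_F_ribbon_list words_inject)
  have "(ribbon :: 'a sentence \<Rightarrow> ('a, 'k) nsym) = (\<lambda>I. ribbon_list (words I))"
    unfolding ribbon_def
    by (rule the_equality) (auto simp: dual intro!: ext qsym_F_separates)
  then show ?thesis by (rule fun_cong)
qed

section \<open>The product rule\<close>

text \<open>This form of the recursion applies to a tail not given by constructors, such as a
  near-concatenation.\<close>

lemma ribbon_list_Cons:
  "ws \<noteq> [] \<Longrightarrow> ribbon_list (w # ws) =
    nsym_H (Abs_sentence [w]) * ribbon_list ws - ribbon_list ((w @ hd ws) # tl ws)"
  by (cases ws) simp_all

lemma ribbon_list_mult:
  "I \<noteq> [] \<Longrightarrow> J \<noteq> [] \<Longrightarrow>
    (ribbon_list I * ribbon_list J :: ('a, 'k::field_char_0) nsym) =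
      ribbon_list (I @ J) + ribbon_list (butlast I @ [last I @ hd J] @ tl J)"
proof (induction I rule: ribbon_list.induct)
  case (2 w)
  \<comment> \<open>With one word on the left, the claim is the recursion for
    \<open>w # J\<close>.\<close>
  then show ?case by (cases J) simp_all
next
  case (3 w v ws)
  let ?H = "nsym_H (Abs_sentence [w])"
  \<comment> \<open>\<open>N\<close> is the near-concatenation of \<open>v # ws\<close> with
    \<open>J\<close>. Prepending \<open>w\<close> to \<open>N\<close>, or merging \<open>w\<close>
    into its first word, gives the near-concatenations for the other two left factors.\<close>
  define N where "N = butlast (v # ws) @ [last (v # ws) @ hd J] @ tl J"
  have N: "N \<noteq> []"
    "butlast (w # v # ws) @ [last (w # v # ws) @ hd J] @ tl J = w # N"
    "butlast ((w @ v) # ws) @ [last ((w @ v) # ws) @ hd J] @ tl J = (w @ hd N) # tl N"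
    unfolding N_def by (cases ws; simp)+
  have "(ribbon_list (w # v # ws) * ribbon_list J :: ('a, 'k) nsym) =
      ?H * (ribbon_list (v # ws) * ribbon_list J) - ribbon_list ((w @ v) # ws) * ribbon_list J"
    by (simp add: left_diff_distrib mult.assoc)
  also have "\<dots> = ?H * (ribbon_list ((v # ws) @ J) + ribbon_list N) -
      (ribbon_list (((w @ v) # ws) @ J) + ribbon_list ((w @ hd N) # tl N))"
    using 3(1,2)[OF list.distinct(2) \<open>J \<noteq> []\<close>] by (simp only: N(3) flip: N_def)
  \<comment> \<open>The recursion is read backwards twice, for the plain concatenation and for
    \<open>w # N\<close>.\<close>
  also have "\<dots> = ribbon_list ((w # v # ws) @ J) + ribbon_list (w # N)"
    by (simp add: ribbon_list_Cons[OF N(1)] distrib_left)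
  finally show ?case by (simp only: N(2))
qed simp

theorem corollary5p6:
  fixes I J :: "'a::finite sentence"
  assumes "I \<noteq> 0" and "J \<noteq> 0"
  shows "(ribbon I * ribbon J :: ('a, 'k::field_char_0) nsym) = ribbon (I \<cdot> J) + ribbon (I \<odot> J)"
proof -
  have "words I \<noteq> []" "words J \<noteq> []"
    using assms by (simp_all add: zero_sentence.rep_eq flip: words_inject)
  \<comment> \<open>Non-emptiness selects the branch of \<open>near_concat\<close> that merges
    words.\<close>
  then show ?thesis
    by (simp add: ribbon_eq_ribbon_list ribbon_list_mult plus_sentence.rep_eq near_concat.rep_eq)
qed

end
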